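(* The calculus fD.LG enjoys (canonical, i.e. Belnap-style) cut-elimination: every fD.LG-derivation can be transformed into an fD.LG-derivation of the same end-sequent in which none of the four cut rules is used.
   Context: **The calculus fD.LG.** Fix two disjoint countably infinite sets of positive atoms $p$ and negative atoms $n$. Formulas of four sorts: pure positive $P ::= p\mid \mathring P\otimes\mathring P\mid \mathring P\oslash\mathring N\mid \mathring N\ominus\mathring P$; pure negative $N ::= n\mid \mathring N\oplus\mathring N\mid \mathring P\backslash\mathring N\mid \mathring N/\mathring P$; shifted positive $\dot P ::= \,\downarrow N$; shifted negative $\dot N ::= \,\uparrow P$. A ring means "pure or shifted": $\mathring P$ (general positive) is $P$ or $\dot P$, $\mathring N$ (general negative) is $N$ or $\dot N$; same convention for structures and for $Q,M,\dots$ Structures (structural connectives carry $\hat{\ }$ or $\check{\ }$): pure positive $X ::= P\mid \check{\Downarrow}\dot\Delta\mid \mathring X\hat\otimes\mathring X\mid\mathring X\hat\oslash\mathring\Delta\mid\mathring\Delta\hat\ominus\mathring X$; pure negative $\Delta ::= N\mid\hat{\Uparrow}\dot X\mid\mathring\Delta\check\oplus\mathring\Delta\mid\mathring X\check\backslash\mathring\Delta\mid\mathring\Delta\check/\mathring X$; shifted positive $\dot X ::= \dot P\mid\check\downarrow\Delta\mid\mathring X\check\oplus_\ell\mathring\Delta\mid\mathring\Delta\check\oplus_r\mathring X\mid\mathring\Delta\check\backslash_\ell\mathring\Delta\mid\mathring X\check\backslash_r\mathring X\mid\mathring X\check/_\ell\mathring X\mid\mathring\Delta\check/_r\mathring\Delta$;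 shifted negative $\dot\Delta ::= \dot N\mid\hat\uparrow X\mid\mathring\Delta\hat\otimes_\ell\mathring X\mid\mathring X\hat\otimes_r\mathring\Delta\mid\mathring\Delta\hat\oslash_\ell\mathring\Delta\mid\mathring X\hat\oslash_r\mathring X\mid\mathring X\hat\ominus_\ell\mathring X\mid\mathring\Delta\hat\ominus_r\mathring\Delta$. Sequents: positive $\mathring X\vdash_+\mathring Y$, negative $\mathring\Gamma\vdash_-\mathring\Delta$, neutral $\mathring X\vdash_0\mathring\Delta$ (the exact turnstile is determined by the sorts of both sides). Rules ($\Rightarrow$: premises to conclusion; $\Leftrightarrow$: both directions). *Axioms:* $p\vdash_+p$; $n\vdash_-n$. *Cuts:* $\mathring X\vdash_+\mathring P,\ \mathring P\vdash_+\mathring Y\Rightarrow\mathring X\vdash_+\mathring Y$; $\mathring\Gamma\vdash_-\mathring N,\ \mathring N\vdash_-\mathring\Delta\Rightarrow\mathring\Gamma\vdash_-\mathring\Delta$; $\mathring X\vdash_+\mathring P,\ \mathring P\vdash_0\mathring\Delta\Rightarrow\mathring X\vdash_0\mathring\Delta$; $\mathring X\vdash_0\mathring N,\ \mathring N\vdash_-\mathring\Delta\Rightarrow\mathring X\vdash_0\mathring\Delta$. *Translation rules:* $\mathring P\hat\otimes\mathring Q\vdash_0\mathring\Delta\Rightarrow\mathring P\otimes\mathring Q\vdash_0\mathring\Delta$; $\mathring P\hat\oslash\mathring N\vdash_0\mathring\Delta\Rightarrow\mathring P\oslash\mathring N\vdash_0\mathring\Delta$; $\mathring N\hat\ominus\mathring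 P\vdash_0\mathring\Delta\Rightarrow\mathring N\ominus\mathring P\vdash_0\mathring\Delta$; $\mathring X\vdash_0\mathring N\check\oplus\mathring M\Rightarrow\mathring X\vdash_0\mathring N\oplus\mathring M$; $\mathring X\vdash_0\mathring P\check\backslash\mathring N\Rightarrow\mathring X\vdash_0\mathring P\backslash\mathring N$; $\mathring X\vdash_0\mathring N\check/\mathring P\Rightarrow\mathring X\vdash_0\mathring N/\mathring P$; $\mathring X\vdash_+\check\downarrow N\Rightarrow\mathring X\vdash_+\downarrow N$; $\hat\uparrow P\vdash_-\mathring\Delta\Rightarrow\ \uparrow P\vdash_-\mathring\Delta$. *Tonicity rules:* $\mathring X\vdash_+\mathring P,\ \mathring Y\vdash_+\mathring Q\Rightarrow\mathring X\hat\otimes\mathring Y\vdash_+\mathring P\otimes\mathring Q$; $\mathring N\vdash_-\mathring\Gamma,\ \mathring M\vdash_-\mathring\Delta\Rightarrow\mathring N\oplus\mathring M\vdash_-\mathring\Gamma\check\oplus\mathring\Delta$; from $\mathring X\vdash_+\mathring P$ and $\mathring N\vdash_-\mathring\Delta$ infer each of $\mathring X\hat\oslash\mathring\Delta\vdash_+\mathring P\oslash\mathring N$, $\ \mathring\Delta\hat\ominus\mathring X\vdash_+\mathring N\ominus\mathring P$, $\ \mathring P\backslash\mathring N\vdash_-\mathring X\check\backslash\mathring\Delta$, $\ \mathring N/\mathring P\vdash_-\mathring\Delta\check/\mathring X$; $N\vdash_-\Delta\Rightarrow\ \downarrow N\vdash_+\check\downarrow\Delta$; $X\vdash_+P\Rightarrow\hat\uparrow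 X\vdash_-\uparrow P$. *Display postulates:* $\mathring Y\vdash_0\mathring X\check\backslash\mathring\Delta\Leftrightarrow\mathring X\hat\otimes\mathring Y\vdash_0\mathring\Delta\Leftrightarrow\mathring X\vdash_0\mathring\Delta\check/\mathring Y$; $\mathring X\hat\oslash\mathring\Delta\vdash_0\mathring\Gamma\Leftrightarrow\mathring X\vdash_0\mathring\Gamma\check\oplus\mathring\Delta\Leftrightarrow\mathring\Gamma\hat\ominus\mathring X\vdash_0\mathring\Delta$; $\mathring Y\vdash_+\mathring X\check\backslash_r\mathring Z\Leftrightarrow\mathring X\hat\otimes\mathring Y\vdash_+\mathring Z\Leftrightarrow\mathring X\vdash_+\mathring Z\check/_\ell\mathring Y$; $\mathring\Sigma\hat\oslash_\ell\mathring\Delta\vdash_-\mathring\Gamma\Leftrightarrow\mathring\Sigma\vdash_-\mathring\Gamma\check\oplus\mathring\Delta\Leftrightarrow\mathring\Gamma\hat\ominus_r\mathring\Sigma\vdash_-\mathring\Delta$; $\mathring\Gamma\hat\ominus\mathring X\vdash_+\mathring Y\Leftrightarrow\mathring X\vdash_+\mathring\Gamma\check\oplus_r\mathring Y\Leftrightarrow\mathring X\hat\oslash_r\mathring Y\vdash_-\mathring\Gamma$; $\mathring X\hat\oslash\mathring\Delta\vdash_+\mathring Y\Leftrightarrow\mathring X\vdash_+\mathring Y\check\oplus_\ell\mathring\Delta\Leftrightarrow\mathring Y\hat\ominus_\ell\mathring X\vdash_-\mathring\Delta$; $\mathring\Gamma\vdash_-\mathring X\check\backslash\mathring\Delta\Leftrightarrow\mathring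 X\hat\otimes_r\mathring\Gamma\vdash_-\mathring\Delta\Leftrightarrow\mathring X\vdash_+\mathring\Delta\check/_r\mathring\Gamma$; $\mathring Y\vdash_+\mathring\Gamma\check\backslash_\ell\mathring\Delta\Leftrightarrow\mathring\Gamma\hat\otimes_\ell\mathring Y\vdash_-\mathring\Delta\Leftrightarrow\mathring\Gamma\vdash_-\mathring\Delta\check/\mathring Y$; $\hat\uparrow X\vdash_-\dot\Delta\Leftrightarrow X\vdash_+\check\Downarrow\dot\Delta$; $\hat\uparrow X\vdash_-\Delta\Leftrightarrow X\vdash_+\check\downarrow\Delta$; $\dot X\vdash_+\check\downarrow\Delta\Leftrightarrow\hat\Uparrow\dot X\vdash_-\Delta$. *Structural rules:* $\mathring X\vdash_0\Delta\Leftrightarrow\mathring X\vdash_+\check\downarrow\Delta$; $X\vdash_0\mathring\Delta\Leftrightarrow\hat\uparrow X\vdash_-\mathring\Delta$. *)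

theory Defs
  imports Main
begin

section \<open>Formulas\<close>

text \<open>
  One type per sort: pure positive, pure negative, shifted positive and shifted negative
  formulas. The types \<open>gposf\<close> and \<open>gnegf\<close> are the general ("pure or shifted", ringed)
  formulas. Atoms are indexed by \<^typ>\<open>nat\<close>; the positive and the negative ones are disjoint because
  they live in different types. The connectives \<open>\<setminus>\<close> and \<open>\<sslash>\<close> are the two residuals
  (backslash and slash) of \<open>\<otimes>\<close>.
\<close>

datatype
      posf  = AtomP nat
            | Tensor gposf gposf (infix "\<otimes>" 70)
            | Oslash gposf gnegf (infix "\<oslash>" 70)
            | Ominus gnegf gposf (infix "\<ominus>" 70)
  and negf  = AtomN nat
            | Oplus gnegf gnegf (infix "\<oplus>" 70)
            | Under gposf gnegf (infix "\<setminus>" 70)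
            | Over gnegf gposf (infix "\<sslash>" 70)
  and sposf = Down negf
  and snegf = Up posf
  and gposf = PureP posf | ShiftP sposf
  and gnegf = PureN negf | ShiftN snegf


section \<open>Structures\<close>

text \<open>
  Again one type per sort, plus the general structures \<open>gpos\<close> and \<open>gneg\<close>. The constructors ending
  in \<open>L\<close> and \<open>R\<close> are the structural connectives with index \<open>\<ell>\<close> and \<open>r\<close>.
\<close>

datatype
      pos  = FmX posf
           | DDownS sneg
           | TensorS gpos gpos
           | OslashS gpos gneg
           | OminusS gneg gpos
  and neg  = FmD negf
           | UUpS spos
           | OplusS gneg gneg
           | UnderS gpos gneg
           | OverS gneg gpos
  and spos = FmSX sposf
           | DownS neg
           | OplusL gpos gneg
           | OplusR gneg gpos
           | UnderL gneg gneg
           | UnderR gpos gpos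
           | OverL gpos gpos
           | OverR gneg gneg
  and sneg = FmSD snegf
           | UpS pos
           | TensorL gneg gpos
           | TensorR gpos gneg
           | OslashL gneg gneg
           | OslashR gpos gpos
           | OminusL gpos gpos
           | OminusR gneg gneg
  and gpos = PureX pos | ShiftX spos
  and gneg = PureD neg | ShiftD sneg

abbreviation pfmP :: "posf \<Rightarrow> gpos" where "pfmP P \<equiv> PureX (FmX P)"
abbreviation sfmP :: "sposf \<Rightarrow> gpos" where "sfmP P \<equiv> ShiftX (FmSX P)"
abbreviation pfmN :: "negf \<Rightarrow> gneg" where "pfmN N \<equiv> PureD (FmD N)"
abbreviation sfmN :: "snegf \<Rightarrow> gneg" where "sfmN N \<equiv> ShiftD (FmSD N)"

fun strP :: "gposf \<Rightarrow> gpos" where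
  "strP (PureP P) = pfmP P"
| "strP (ShiftP P) = sfmP P"

fun strN :: "gnegf \<Rightarrow> gneg" where
  "strN (PureN N) = pfmN N"
| "strN (ShiftN N) = sfmN N"

text \<open>
  Infix notation for structural connectives, with the result injected into the general structures.
\<close>

abbreviation tensor_s (infix "\<otimes>\<^sub>s" 70) where "X \<otimes>\<^sub>s Y \<equiv> PureX (TensorS X Y)"
abbreviation oslash_s (infix "\<oslash>\<^sub>s" 70) where "X \<oslash>\<^sub>s D \<equiv> PureX (OslashS X D)"
abbreviation ominus_s (infix "\<ominus>\<^sub>s" 70) where "D \<ominus>\<^sub>s X \<equiv> PureX (OminusS D X)"
abbreviation oplus_s (infix "\<oplus>\<^sub>s" 70) where "C \<oplus>\<^sub>s D \<equiv> PureD (OplusS C D)"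
abbreviation under_s (infix "\<setminus>\<^sub>s" 70) where "X \<setminus>\<^sub>s D \<equiv> PureD (UnderS X D)"
abbreviation over_s (infix "\<sslash>\<^sub>s" 70) where "D \<sslash>\<^sub>s X \<equiv> PureD (OverS D X)"

abbreviation oplus_l (infix "\<oplus>\<^sub>l" 70) where "X \<oplus>\<^sub>l D \<equiv> ShiftX (OplusL X D)"
abbreviation oplus_r (infix "\<oplus>\<^sub>r" 70) where "D \<oplus>\<^sub>r X \<equiv> ShiftX (OplusR D X)"
abbreviation under_l (infix "\<setminus>\<^sub>l" 70) where "C \<setminus>\<^sub>l D \<equiv> ShiftX (UnderL C D)"
abbreviation under_r (infix "\<setminus>\<^sub>r" 70) where "X \<setminus>\<^sub>r Y \<equiv> ShiftX (UnderR X Y)"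
abbreviation over_l (infix "\<sslash>\<^sub>l" 70) where "X \<sslash>\<^sub>l Y \<equiv> ShiftX (OverL X Y)"
abbreviation over_r (infix "\<sslash>\<^sub>r" 70) where "C \<sslash>\<^sub>r D \<equiv> ShiftX (OverR C D)"

abbreviation tensor_l (infix "\<otimes>\<^sub>l" 70) where "D \<otimes>\<^sub>l X \<equiv> ShiftD (TensorL D X)"
abbreviation tensor_r (infix "\<otimes>\<^sub>r" 70) where "X \<otimes>\<^sub>r D \<equiv> ShiftD (TensorR X D)"
abbreviation oslash_l (infix "\<oslash>\<^sub>l" 70) where "C \<oslash>\<^sub>l D \<equiv> ShiftD (OslashL C D)"
abbreviation oslash_r (infix "\<oslash>\<^sub>r" 70) where "X \<oslash>\<^sub>r Y \<equiv> ShiftD (OslashR X Y)"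
abbreviation ominus_l (infix "\<ominus>\<^sub>l" 70) where "X \<ominus>\<^sub>l Y \<equiv> ShiftD (OminusL X Y)"
abbreviation ominus_r (infix "\<ominus>\<^sub>r" 70) where "C \<ominus>\<^sub>r D \<equiv> ShiftD (OminusR C D)"

abbreviation down_s ("\<down>\<^sub>s _" [80] 80) where "\<down>\<^sub>s D \<equiv> ShiftX (DownS D)"
abbreviation up_s ("\<up>\<^sub>s _" [80] 80) where "\<up>\<^sub>s X \<equiv> ShiftD (UpS X)"
abbreviation ddown_s ("\<Down>\<^sub>s _" [80] 80) where "\<Down>\<^sub>s D \<equiv> PureX (DDownS D)"
abbreviation uup_s ("\<Up>\<^sub>s _" [80] 80) where "\<Up>\<^sub>s X \<equiv> PureD (UUpS X)"


section \<open>Sequents and rules\<close>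

text \<open>
  In the rules, \<open>X, Y, Z\<close> and \<open>C, D, S\<close> are general structures and \<open>P, Q, N, M\<close> below \<open>strP\<close> and
  \<open>strN\<close> general formulas; \<open>\<Xi>, \<Delta>\<close> are pure and \<open>\<Xi>', \<Delta>'\<close> shifted structures.
\<close>

datatype sequent =
    SeqPos gpos gpos (infix "\<turnstile>\<^sub>+" 50)
  | SeqNeg gneg gneg (infix "\<turnstile>\<^sub>-" 50)
  | SeqNeu gpos gneg (infix "\<turnstile>\<^sub>0" 50)

inductive axiom_rule :: "sequent list \<Rightarrow> sequent \<Rightarrow> bool" where
  "axiom_rule [] (pfmP (AtomP p) \<turnstile>\<^sub>+ pfmP (AtomP p))"
| "axiom_rule [] (pfmN (AtomN n) \<turnstile>\<^sub>- pfmN (AtomN n))"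

inductive cut_rule :: "sequent list \<Rightarrow> sequent \<Rightarrow> bool" where
  "cut_rule [X \<turnstile>\<^sub>+ strP P, strP P \<turnstile>\<^sub>+ Y] (X \<turnstile>\<^sub>+ Y)"
| "cut_rule [C \<turnstile>\<^sub>- strN N, strN N \<turnstile>\<^sub>- D] (C \<turnstile>\<^sub>- D)"
| "cut_rule [X \<turnstile>\<^sub>+ strP P, strP P \<turnstile>\<^sub>0 D] (X \<turnstile>\<^sub>0 D)"
| "cut_rule [X \<turnstile>\<^sub>0 strN N, strN N \<turnstile>\<^sub>- D] (X \<turnstile>\<^sub>0 D)"

inductive translation_rule :: "sequent list \<Rightarrow> sequent \<Rightarrow> bool" where
  "translation_rule [strP P \<otimes>\<^sub>s strP Q \<turnstile>\<^sub>0 D] (pfmP (P \<otimes> Q) \<turnstile>\<^sub>0 D)"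
| "translation_rule [strP P \<oslash>\<^sub>s strN N \<turnstile>\<^sub>0 D] (pfmP (P \<oslash> N) \<turnstile>\<^sub>0 D)"
| "translation_rule [strN N \<ominus>\<^sub>s strP P \<turnstile>\<^sub>0 D] (pfmP (N \<ominus> P) \<turnstile>\<^sub>0 D)"
| "translation_rule [X \<turnstile>\<^sub>0 strN N \<oplus>\<^sub>s strN M] (X \<turnstile>\<^sub>0 pfmN (N \<oplus> M))"
| "translation_rule [X \<turnstile>\<^sub>0 strP P \<setminus>\<^sub>s strN N] (X \<turnstile>\<^sub>0 pfmN (P \<setminus> N))"
| "translation_rule [X \<turnstile>\<^sub>0 strN N \<sslash>\<^sub>s strP P] (X \<turnstile>\<^sub>0 pfmN (N \<sslash> P))"
| "translation_rule [X \<turnstile>\<^sub>+ \<down>\<^sub>s (FmD N)] (X \<turnstile>\<^sub>+ sfmP (Down N))"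
| "translation_rule [\<up>\<^sub>s (FmX P) \<turnstile>\<^sub>- D] (sfmN (Up P) \<turnstile>\<^sub>- D)"

inductive tonicity_rule :: "sequent list \<Rightarrow> sequent \<Rightarrow> bool" where
  "tonicity_rule [X \<turnstile>\<^sub>+ strP P, Y \<turnstile>\<^sub>+ strP Q] (X \<otimes>\<^sub>s Y \<turnstile>\<^sub>+ pfmP (P \<otimes> Q))"
| "tonicity_rule [strN N \<turnstile>\<^sub>- C, strN M \<turnstile>\<^sub>- D] (pfmN (N \<oplus> M) \<turnstile>\<^sub>- C \<oplus>\<^sub>s D)"
| "tonicity_rule [X \<turnstile>\<^sub>+ strP P, strN N \<turnstile>\<^sub>- D] (X \<oslash>\<^sub>s D \<turnstile>\<^sub>+ pfmP (P \<oslash> N))"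
| "tonicity_rule [X \<turnstile>\<^sub>+ strP P, strN N \<turnstile>\<^sub>- D] (D \<ominus>\<^sub>s X \<turnstile>\<^sub>+ pfmP (N \<ominus> P))"
| "tonicity_rule [X \<turnstile>\<^sub>+ strP P, strN N \<turnstile>\<^sub>- D] (pfmN (P \<setminus> N) \<turnstile>\<^sub>- X \<setminus>\<^sub>s D)"
| "tonicity_rule [X \<turnstile>\<^sub>+ strP P, strN N \<turnstile>\<^sub>- D] (pfmN (N \<sslash> P) \<turnstile>\<^sub>- D \<sslash>\<^sub>s X)"
| "tonicity_rule [pfmN N \<turnstile>\<^sub>- PureD \<Delta>] (sfmP (Down N) \<turnstile>\<^sub>+ \<down>\<^sub>s \<Delta>)"
| "tonicity_rule [PureX \<Xi> \<turnstile>\<^sub>+ pfmP P] (\<up>\<^sub>s \<Xi> \<turnstile>\<^sub>- sfmN (Up P))"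

text \<open>
  The next two relations list the invertible postulates, one clause per double arrow; the
  corresponding rules may be applied in both directions.
\<close>

inductive display_postulate :: "sequent \<Rightarrow> sequent \<Rightarrow> bool" where
  "display_postulate (Y \<turnstile>\<^sub>0 X \<setminus>\<^sub>s D) (X \<otimes>\<^sub>s Y \<turnstile>\<^sub>0 D)"
| "display_postulate (X \<otimes>\<^sub>s Y \<turnstile>\<^sub>0 D) (X \<turnstile>\<^sub>0 D \<sslash>\<^sub>s Y)"
| "display_postulate (X \<oslash>\<^sub>s D \<turnstile>\<^sub>0 C) (X \<turnstile>\<^sub>0 C \<oplus>\<^sub>s D)"
| "display_postulate (X \<turnstile>\<^sub>0 C \<oplus>\<^sub>s D) (C \<ominus>\<^sub>s X \<turnstile>\<^sub>0 D)"
| "display_postulate (Y \<turnstile>\<^sub>+ X \<setminus>\<^sub>r Z) (X \<otimes>\<^sub>s Y \<turnstile>\<^sub>+ Z)"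
| "display_postulate (X \<otimes>\<^sub>s Y \<turnstile>\<^sub>+ Z) (X \<turnstile>\<^sub>+ Z \<sslash>\<^sub>l Y)"
| "display_postulate (S \<oslash>\<^sub>l D \<turnstile>\<^sub>- C) (S \<turnstile>\<^sub>- C \<oplus>\<^sub>s D)"
| "display_postulate (S \<turnstile>\<^sub>- C \<oplus>\<^sub>s D) (C \<ominus>\<^sub>r S \<turnstile>\<^sub>- D)"
| "display_postulate (C \<ominus>\<^sub>s X \<turnstile>\<^sub>+ Y) (X \<turnstile>\<^sub>+ C \<oplus>\<^sub>r Y)"
| "display_postulate (X \<turnstile>\<^sub>+ C \<oplus>\<^sub>r Y) (X \<oslash>\<^sub>r Y \<turnstile>\<^sub>- C)"
| "display_postulate (X \<oslash>\<^sub>s D \<turnstile>\<^sub>+ Y) (X \<turnstile>\<^sub>+ Y \<oplus>\<^sub>l D)"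
| "display_postulate (X \<turnstile>\<^sub>+ Y \<oplus>\<^sub>l D) (Y \<ominus>\<^sub>l X \<turnstile>\<^sub>- D)"
| "display_postulate (C \<turnstile>\<^sub>- X \<setminus>\<^sub>s D) (X \<otimes>\<^sub>r C \<turnstile>\<^sub>- D)"
| "display_postulate (X \<otimes>\<^sub>r C \<turnstile>\<^sub>- D) (X \<turnstile>\<^sub>+ D \<sslash>\<^sub>r C)"
| "display_postulate (Y \<turnstile>\<^sub>+ C \<setminus>\<^sub>l D) (C \<otimes>\<^sub>l Y \<turnstile>\<^sub>- D)"
| "display_postulate (C \<otimes>\<^sub>l Y \<turnstile>\<^sub>- D) (C \<turnstile>\<^sub>- D \<sslash>\<^sub>s Y)"
| "display_postulate (\<up>\<^sub>s \<Xi> \<turnstile>\<^sub>- ShiftD \<Delta>') (PureX \<Xi> \<turnstile>\<^sub>+ \<Down>\<^sub>s \<Delta>')"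
| "display_postulate (\<up>\<^sub>s \<Xi> \<turnstile>\<^sub>- PureD \<Delta>) (PureX \<Xi> \<turnstile>\<^sub>+ \<down>\<^sub>s \<Delta>)"
| "display_postulate (ShiftX \<Xi>' \<turnstile>\<^sub>+ \<down>\<^sub>s \<Delta>) (\<Up>\<^sub>s \<Xi>' \<turnstile>\<^sub>- PureD \<Delta>)"

inductive structural_postulate :: "sequent \<Rightarrow> sequent \<Rightarrow> bool" where
  "structural_postulate (X \<turnstile>\<^sub>0 PureD \<Delta>) (X \<turnstile>\<^sub>+ \<down>\<^sub>s \<Delta>)"
| "structural_postulate (PureX \<Xi> \<turnstile>\<^sub>0 D) (\<up>\<^sub>s \<Xi> \<turnstile>\<^sub>- D)"

datatype rule_kind = Axiom | Cut | Translation | Tonicity | Display | Structural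

inductive fDLG_rule :: "rule_kind \<Rightarrow> sequent list \<Rightarrow> sequent \<Rightarrow> bool" where
  "axiom_rule ps c \<Longrightarrow> fDLG_rule Axiom ps c"
| "cut_rule ps c \<Longrightarrow> fDLG_rule Cut ps c"
| "translation_rule ps c \<Longrightarrow> fDLG_rule Translation ps c"
| "tonicity_rule ps c \<Longrightarrow> fDLG_rule Tonicity ps c"
| "display_postulate s t \<Longrightarrow> fDLG_rule Display [s] t"
| "display_postulate s t \<Longrightarrow> fDLG_rule Display [t] s"
| "structural_postulate s t \<Longrightarrow> fDLG_rule Structural [s] t"
| "structural_postulate s t \<Longrightarrow> fDLG_rule Structural [t] s"


section \<open>Derivations\<close>

text \<open>
  Each node carries the kind of the rule applied there, the sequent derived and the derivations of
  the premises.
\<close>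

datatype deriv = Infer rule_kind (end_sequent: sequent) "deriv list"

inductive fDLG_derivation :: "deriv \<Rightarrow> bool" where
  "fDLG_rule k (map end_sequent ds) c \<Longrightarrow> (\<And>d. d \<in> set ds \<Longrightarrow> fDLG_derivation d)
    \<Longrightarrow> fDLG_derivation (Infer k c ds)"

fun cut_free :: "deriv \<Rightarrow> bool" where
  "cut_free (Infer k c ds) \<longleftrightarrow> k \<noteq> Cut \<and> (\<forall>d \<in> set ds. cut_free d)"

end

theory Submission
  imports Defs
begin

text \<open>
  Neutral cuts reduce to cuts on \<open>\<turnstile>\<^sub>+\<close> or \<open>\<turnstile>\<^sub>-\<close>: a cut-free derivable neutral sequent has a pure side, and
  the structural postulates turn it into an equivalent positive or negative sequent. What makes this
  work is that shifted structures never entail a pure positive formula, and dually.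

  For a positive cut on \<open>P\<close>, the occurrence of \<open>P\<close> in the left premise is a succedent part and is
  traced upwards through all display and structural steps, being replaced by \<open>Y\<close>, until it is
  introduced in some \<open>X' \<turnstile>\<^sub>+ P\<close>. There the antecedent part \<open>P\<close> of the right premise \<open>P \<turnstile>\<^sub>+ Y\<close> is traced
  upwards in the same way, now being replaced by \<open>X'\<close>, until it is introduced as well; such a
  principal cut reduces to cuts on the immediate subformulas of \<open>P\<close>. Negative cuts are dual: the
  right premise is traced first. This order matters: it guarantees that a pure \<open>P\<close> in antecedent
  position is only ever replaced by a pure structure, as required below \<open>\<up>\<^sub>s\<close>.
\<close>

section \<open>Rules by side of introduction, and cut-free derivability\<close>

inductive postulate :: "sequent \<Rightarrow> sequent \<Rightarrow> bool" where
  "display_postulate s t \<Longrightarrow> postulate s t"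
| "display_postulate s t \<Longrightarrow> postulate t s"
| "structural_postulate s t \<Longrightarrow> postulate s t"
| "structural_postulate s t \<Longrightarrow> postulate t s"

lemma postulate_sym: "postulate s t \<Longrightarrow> postulate t s"
  by (auto elim!: postulate.cases intro: postulate.intros)

text \<open>Translation and tonicity rules are regrouped by the side of the new formula: the trace
  of an antecedent occurrence ends only at a rule of this group or at an axiom.\<close>

inductive left_rule :: "sequent list \<Rightarrow> sequent \<Rightarrow> bool" where
  "left_rule [strP P \<otimes>\<^sub>s strP Q \<turnstile>\<^sub>0 D] (pfmP (P \<otimes> Q) \<turnstile>\<^sub>0 D)"
| "left_rule [strP P \<oslash>\<^sub>s strN N \<turnstile>\<^sub>0 D] (pfmP (P \<oslash> N) \<turnstile>\<^sub>0 D)"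
| "left_rule [strN N \<ominus>\<^sub>s strP P \<turnstile>\<^sub>0 D] (pfmP (N \<ominus> P) \<turnstile>\<^sub>0 D)"
| "left_rule [\<up>\<^sub>s (FmX P') \<turnstile>\<^sub>- D] (sfmN (Up P') \<turnstile>\<^sub>- D)"
| "left_rule [strN N \<turnstile>\<^sub>- C, strN M \<turnstile>\<^sub>- D] (pfmN (N \<oplus> M) \<turnstile>\<^sub>- C \<oplus>\<^sub>s D)"
| "left_rule [X \<turnstile>\<^sub>+ strP P, strN N \<turnstile>\<^sub>- D] (pfmN (P \<setminus> N) \<turnstile>\<^sub>- X \<setminus>\<^sub>s D)"
| "left_rule [X \<turnstile>\<^sub>+ strP P, strN N \<turnstile>\<^sub>- D] (pfmN (N \<sslash> P) \<turnstile>\<^sub>- D \<sslash>\<^sub>s X)"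
| "left_rule [pfmN N' \<turnstile>\<^sub>- PureD \<Delta>] (sfmP (Down N') \<turnstile>\<^sub>+ \<down>\<^sub>s \<Delta>)"

inductive right_rule :: "sequent list \<Rightarrow> sequent \<Rightarrow> bool" where
  "right_rule [X \<turnstile>\<^sub>0 strN N \<oplus>\<^sub>s strN M] (X \<turnstile>\<^sub>0 pfmN (N \<oplus> M))"
| "right_rule [X \<turnstile>\<^sub>0 strP P \<setminus>\<^sub>s strN N] (X \<turnstile>\<^sub>0 pfmN (P \<setminus> N))"
| "right_rule [X \<turnstile>\<^sub>0 strN N \<sslash>\<^sub>s strP P] (X \<turnstile>\<^sub>0 pfmN (N \<sslash> P))"
| "right_rule [X \<turnstile>\<^sub>+ \<down>\<^sub>s (FmD N')] (X \<turnstile>\<^sub>+ sfmP (Down N'))"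
| "right_rule [X \<turnstile>\<^sub>+ strP P, Y \<turnstile>\<^sub>+ strP Q] (X \<otimes>\<^sub>s Y \<turnstile>\<^sub>+ pfmP (P \<otimes> Q))"
| "right_rule [X \<turnstile>\<^sub>+ strP P, strN N \<turnstile>\<^sub>- D] (X \<oslash>\<^sub>s D \<turnstile>\<^sub>+ pfmP (P \<oslash> N))"
| "right_rule [X \<turnstile>\<^sub>+ strP P, strN N \<turnstile>\<^sub>- D] (D \<ominus>\<^sub>s X \<turnstile>\<^sub>+ pfmP (N \<ominus> P))"
| "right_rule [PureX \<Xi> \<turnstile>\<^sub>+ pfmP P'] (\<up>\<^sub>s \<Xi> \<turnstile>\<^sub>- sfmN (Up P'))"

text \<open>A predicate on sequents is enough for the whole argument; trees are rebuilt by
  \<open>cf_derivable_imp_cf_derivation\<close>.\<close>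

inductive cf_derivable :: "sequent \<Rightarrow> bool" where
  axiom: "axiom_rule ps c \<Longrightarrow> cf_derivable c"
| left: "left_rule ps c \<Longrightarrow> (\<And>p. p \<in> set ps \<Longrightarrow> cf_derivable p) \<Longrightarrow> cf_derivable c"
| right: "right_rule ps c \<Longrightarrow> (\<And>p. p \<in> set ps \<Longrightarrow> cf_derivable p) \<Longrightarrow> cf_derivable c"
| post: "postulate s t \<Longrightarrow> cf_derivable s \<Longrightarrow> cf_derivable t"

section \<open>Replacing a formula at parts of fixed polarity\<close>

lemma strP_eq_simps [simp]:
  "strP P = PureX x \<longleftrightarrow> (\<exists>p. P = PureP p \<and> x = FmX p)"
  "PureX x = strP P \<longleftrightarrow> (\<exists>p. P = PureP p \<and> x = FmX p)"
  "strP P = ShiftX y \<longleftrightarrow> (\<exists>p. P = ShiftP p \<and> y = FmSX p)"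
  "ShiftX y = strP P \<longleftrightarrow> (\<exists>p. P = ShiftP p \<and> y = FmSX p)"
  by (cases P; auto)+

lemma strN_eq_simps [simp]:
  "strN N = PureD x \<longleftrightarrow> (\<exists>n. N = PureN n \<and> x = FmD n)"
  "PureD x = strN N \<longleftrightarrow> (\<exists>n. N = PureN n \<and> x = FmD n)"
  "strN N = ShiftD y \<longleftrightarrow> (\<exists>n. N = ShiftN n \<and> y = FmSD n)"
  "ShiftD y = strN N \<longleftrightarrow> (\<exists>n. N = ShiftN n \<and> y = FmSD n)"
  by (cases N; auto)+

lemma strP_inject [simp]: "strP P = strP Q \<longleftrightarrow> P = Q"
  by (cases P; cases Q) auto

lemma strN_inject [simp]: "strN N = strN M \<longleftrightarrow> N = M"
  by (cases N; cases M) auto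

text \<open>
  \<open>AntP P X\<close> licenses replacing \<open>P\<close> by \<open>X\<close> at antecedent parts, and so on. The relations \<open>antP\<close>, \<open>sucP\<close>,
  \<open>antN\<close>, \<open>sucN\<close> descend only through connectives that can occur at the given polarity in a derivable
  sequent, and may leave occurrences unreplaced. A shifted formula may be replaced by a pure
  structure, in which case an enclosing \<open>\<Down>\<^sub>s\<close> becomes \<open>\<down>\<^sub>s\<close> and \<open>\<Up>\<^sub>s\<close> becomes \<open>\<up>\<^sub>s\<close>.
\<close>

datatype replacement =
    AntP gposf gpos | SucP gposf gpos | AntN gnegf gneg | SucN gnegf gneg

inductive antP sucP :: "replacement \<Rightarrow> gpos \<Rightarrow> gpos \<Rightarrow> bool"
  and antN sucN :: "replacement \<Rightarrow> gneg \<Rightarrow> gneg \<Rightarrow> bool" for r where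
  "antP r X X"
| "r = AntP P X \<Longrightarrow> antP r (strP P) X"
| "antP r X X' \<Longrightarrow> antP r Y Y' \<Longrightarrow> antP r (X \<otimes>\<^sub>s Y) (X' \<otimes>\<^sub>s Y')"
| "antP r X X' \<Longrightarrow> sucN r D D' \<Longrightarrow> antP r (X \<oslash>\<^sub>s D) (X' \<oslash>\<^sub>s D')"
| "sucN r D D' \<Longrightarrow> antP r X X' \<Longrightarrow> antP r (D \<ominus>\<^sub>s X) (D' \<ominus>\<^sub>s X')"
| "sucP r X X"
| "r = SucP P X \<Longrightarrow> sucP r (strP P) X"
| "sucN r (ShiftD \<Delta>) (ShiftD \<Delta>') \<Longrightarrow> sucP r (\<Down>\<^sub>s \<Delta>) (\<Down>\<^sub>s \<Delta>')"
| "sucN r (ShiftD \<Delta>) (PureD \<Delta>'') \<Longrightarrow> sucP r (\<Down>\<^sub>s \<Delta>) (\<down>\<^sub>s \<Delta>'')"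
| "sucN r (PureD \<Gamma>) (PureD \<Gamma>') \<Longrightarrow> sucP r (\<down>\<^sub>s \<Gamma>) (\<down>\<^sub>s \<Gamma>')"
| "sucP r X X' \<Longrightarrow> sucN r D D' \<Longrightarrow> sucP r (X \<oplus>\<^sub>l D) (X' \<oplus>\<^sub>l D')"
| "sucN r D D' \<Longrightarrow> sucP r X X' \<Longrightarrow> sucP r (D \<oplus>\<^sub>r X) (D' \<oplus>\<^sub>r X')"
| "antN r C C' \<Longrightarrow> sucN r D D' \<Longrightarrow> sucP r (C \<setminus>\<^sub>l D) (C' \<setminus>\<^sub>l D')"
| "antP r X X' \<Longrightarrow> sucP r Y Y' \<Longrightarrow> sucP r (X \<setminus>\<^sub>r Y) (X' \<setminus>\<^sub>r Y')"
| "sucP r X X' \<Longrightarrow> antP r Y Y' \<Longrightarrow> sucP r (X \<sslash>\<^sub>l Y) (X' \<sslash>\<^sub>l Y')"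
| "sucN r C C' \<Longrightarrow> antN r D D' \<Longrightarrow> sucP r (C \<sslash>\<^sub>r D) (C' \<sslash>\<^sub>r D')"
| "antN r D D"
| "r = AntN N D \<Longrightarrow> antN r (strN N) D"
| "antP r (ShiftX \<Xi>) (ShiftX \<Xi>') \<Longrightarrow> antN r (\<Up>\<^sub>s \<Xi>) (\<Up>\<^sub>s \<Xi>')"
| "antP r (ShiftX \<Xi>) (PureX \<Xi>'') \<Longrightarrow> antN r (\<Up>\<^sub>s \<Xi>) (\<up>\<^sub>s \<Xi>'')"
| "antP r (PureX \<Theta>) (PureX \<Theta>') \<Longrightarrow> antN r (\<up>\<^sub>s \<Theta>) (\<up>\<^sub>s \<Theta>')"
| "antN r D D' \<Longrightarrow> antP r X X' \<Longrightarrow> antN r (D \<otimes>\<^sub>l X) (D' \<otimes>\<^sub>l X')"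
| "antP r X X' \<Longrightarrow> antN r D D' \<Longrightarrow> antN r (X \<otimes>\<^sub>r D) (X' \<otimes>\<^sub>r D')"
| "antN r C C' \<Longrightarrow> sucN r D D' \<Longrightarrow> antN r (C \<oslash>\<^sub>l D) (C' \<oslash>\<^sub>l D')"
| "antP r X X' \<Longrightarrow> sucP r Y Y' \<Longrightarrow> antN r (X \<oslash>\<^sub>r Y) (X' \<oslash>\<^sub>r Y')"
| "sucP r X X' \<Longrightarrow> antP r Y Y' \<Longrightarrow> antN r (X \<ominus>\<^sub>l Y) (X' \<ominus>\<^sub>l Y')"
| "sucN r C C' \<Longrightarrow> antN r D D' \<Longrightarrow> antN r (C \<ominus>\<^sub>r D) (C' \<ominus>\<^sub>r D')"
| "sucN r D D"
| "r = SucN N D \<Longrightarrow> sucN r (strN N) D"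
| "sucN r C C' \<Longrightarrow> sucN r D D' \<Longrightarrow> sucN r (C \<oplus>\<^sub>s D) (C' \<oplus>\<^sub>s D')"
| "antP r X X' \<Longrightarrow> sucN r D D' \<Longrightarrow> sucN r (X \<setminus>\<^sub>s D) (X' \<setminus>\<^sub>s D')"
| "sucN r D D' \<Longrightarrow> antP r X X' \<Longrightarrow> sucN r (D \<sslash>\<^sub>s X) (D' \<sslash>\<^sub>s X')"

fun replaces :: "replacement \<Rightarrow> sequent \<Rightarrow> sequent \<Rightarrow> bool" where
  "replaces r (X \<turnstile>\<^sub>+ Y) (X' \<turnstile>\<^sub>+ Y') \<longleftrightarrow> antP r X X' \<and> sucP r Y Y'"
| "replaces r (C \<turnstile>\<^sub>- D) (C' \<turnstile>\<^sub>- D') \<longleftrightarrow> antN r C C' \<and> sucN r D D'"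
| "replaces r (X \<turnstile>\<^sub>0 D) (X' \<turnstile>\<^sub>0 D') \<longleftrightarrow> antP r X X' \<and> sucN r D D'"
| "replaces r _ _ \<longleftrightarrow> False"

lemma replacement_refl [simp]: "antP r X X" "sucP r X X" "antN r D D" "sucN r D D"
  by (rule antP_sucP_antN_sucN.intros)+

lemma replaces_cases:
  "replaces r (X \<turnstile>\<^sub>+ Y) c \<longleftrightarrow> (\<exists>X' Y'. c = (X' \<turnstile>\<^sub>+ Y') \<and> antP r X X' \<and> sucP r Y Y')"
  "replaces r (C \<turnstile>\<^sub>- D) c \<longleftrightarrow> (\<exists>C' D'. c = (C' \<turnstile>\<^sub>- D') \<and> antN r C C' \<and> sucN r D D')"
  "replaces r (X \<turnstile>\<^sub>0 D) c \<longleftrightarrow> (\<exists>X' D'. c = (X' \<turnstile>\<^sub>0 D') \<and> antP r X X' \<and> sucN r D D')"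
  by (cases c; auto)+

text \<open>Only pure structures may stand below \<open>\<up>\<^sub>s\<close> and
  \<open>\<down>\<^sub>s\<close>. The first holds positive antecedent parts, the second negative
  succedent parts, hence the constraints on \<open>AntP\<close> and \<open>SucN\<close>.\<close>

fun keeps_pure :: "replacement \<Rightarrow> bool" where
  "keeps_pure (AntP (PureP P) X) \<longleftrightarrow> (\<exists>\<Xi>. X = PureX \<Xi>)"
| "keeps_pure (SucN (PureN N) D) \<longleftrightarrow> (\<exists>\<Delta>. D = PureD \<Delta>)"
| "keeps_pure _ \<longleftrightarrow> True"

lemma antP_pure: "antP r (PureX \<Xi>) X \<Longrightarrow> keeps_pure r \<Longrightarrow> \<exists>\<Xi>'. X = PureX \<Xi>'"
  by (erule antP.cases) auto

lemma sucN_pure: "sucN r (PureD \<Delta>) D \<Longrightarrow> keeps_pure r \<Longrightarrow> \<exists>\<Delta>'. D = PureD \<Delta>'"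
  by (erule sucN.cases) auto

text \<open>Componentwise equations absorb the identity clause, since each part may itself stay
  unchanged. Formulas get three equations because rules mention them as \<open>strP P\<close> and in
  both evaluated shapes.\<close>

lemma antP_inv:
  "antP r (X \<otimes>\<^sub>s Y) Z \<longleftrightarrow> (\<exists>X' Y'. Z = X' \<otimes>\<^sub>s Y' \<and> antP r X X' \<and> antP r Y Y')"
  "antP r (X \<oslash>\<^sub>s D) Z \<longleftrightarrow> (\<exists>X' D'. Z = X' \<oslash>\<^sub>s D' \<and> antP r X X' \<and> sucN r D D')"
  "antP r (D \<ominus>\<^sub>s X) Z \<longleftrightarrow> (\<exists>X' D'. Z = D' \<ominus>\<^sub>s X' \<and> antP r X X' \<and> sucN r D D')"
  "antP r (strP P) Z \<longleftrightarrow> Z = strP P \<or> r = AntP P Z"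
  "antP r (pfmP p) Z \<longleftrightarrow> Z = pfmP p \<or> r = AntP (PureP p) Z"
  "antP r (sfmP q) Z \<longleftrightarrow> Z = sfmP q \<or> r = AntP (ShiftP q) Z"
  by (subst antP.simps; auto)+

lemma sucP_inv:
  "sucP r (\<Down>\<^sub>s \<Delta>) Z \<longleftrightarrow> (\<exists>\<Delta>'. Z = \<Down>\<^sub>s \<Delta>' \<and> sucN r (ShiftD \<Delta>) (ShiftD \<Delta>'))
    \<or> (\<exists>\<Delta>'. Z = \<down>\<^sub>s \<Delta>' \<and> sucN r (ShiftD \<Delta>) (PureD \<Delta>'))"
  "sucP r (\<down>\<^sub>s \<Gamma>) Z \<longleftrightarrow> (\<exists>\<Gamma>'. Z = \<down>\<^sub>s \<Gamma>' \<and> sucN r (PureD \<Gamma>) (PureD \<Gamma>'))"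
  "sucP r (X \<oplus>\<^sub>l D) Z \<longleftrightarrow> (\<exists>X' D'. Z = X' \<oplus>\<^sub>l D' \<and> sucP r X X' \<and> sucN r D D')"
  "sucP r (D \<oplus>\<^sub>r X) Z \<longleftrightarrow> (\<exists>X' D'. Z = D' \<oplus>\<^sub>r X' \<and> sucP r X X' \<and> sucN r D D')"
  "sucP r (C \<setminus>\<^sub>l D) Z \<longleftrightarrow> (\<exists>C' D'. Z = C' \<setminus>\<^sub>l D' \<and> antN r C C' \<and> sucN r D D')"
  "sucP r (X \<setminus>\<^sub>r Y) Z \<longleftrightarrow> (\<exists>X' Y'. Z = X' \<setminus>\<^sub>r Y' \<and> antP r X X' \<and> sucP r Y Y')"
  "sucP r (X \<sslash>\<^sub>l Y) Z \<longleftrightarrow> (\<exists>X' Y'. Z = X' \<sslash>\<^sub>l Y' \<and> sucP r X X' \<and> antP r Y Y')"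
  "sucP r (C \<sslash>\<^sub>r D) Z \<longleftrightarrow> (\<exists>C' D'. Z = C' \<sslash>\<^sub>r D' \<and> sucN r C C' \<and> antN r D D')"
  "sucP r (strP P) Z \<longleftrightarrow> Z = strP P \<or> r = SucP P Z"
  "sucP r (pfmP p) Z \<longleftrightarrow> Z = pfmP p \<or> r = SucP (PureP p) Z"
  "sucP r (sfmP q) Z \<longleftrightarrow> Z = sfmP q \<or> r = SucP (ShiftP q) Z"
  by (subst sucP.simps; auto)+

lemma antN_inv:
  "antN r (\<Up>\<^sub>s \<Xi>) Z \<longleftrightarrow> (\<exists>\<Xi>'. Z = \<Up>\<^sub>s \<Xi>' \<and> antP r (ShiftX \<Xi>) (ShiftX \<Xi>'))
    \<or> (\<exists>\<Xi>'. Z = \<up>\<^sub>s \<Xi>' \<and> antP r (ShiftX \<Xi>) (PureX \<Xi>'))"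
  "antN r (\<up>\<^sub>s \<Theta>) Z \<longleftrightarrow> (\<exists>\<Theta>'. Z = \<up>\<^sub>s \<Theta>' \<and> antP r (PureX \<Theta>) (PureX \<Theta>'))"
  "antN r (D \<otimes>\<^sub>l X) Z \<longleftrightarrow> (\<exists>D' X'. Z = D' \<otimes>\<^sub>l X' \<and> antN r D D' \<and> antP r X X')"
  "antN r (X \<otimes>\<^sub>r D) Z \<longleftrightarrow> (\<exists>D' X'. Z = X' \<otimes>\<^sub>r D' \<and> antN r D D' \<and> antP r X X')"
  "antN r (C \<oslash>\<^sub>l D) Z \<longleftrightarrow> (\<exists>C' D'. Z = C' \<oslash>\<^sub>l D' \<and> antN r C C' \<and> sucN r D D')"
  "antN r (X \<oslash>\<^sub>r Y) Z \<longleftrightarrow> (\<exists>X' Y'. Z = X' \<oslash>\<^sub>r Y' \<and> antP r X X' \<and> sucP r Y Y')"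
  "antN r (X \<ominus>\<^sub>l Y) Z \<longleftrightarrow> (\<exists>X' Y'. Z = X' \<ominus>\<^sub>l Y' \<and> sucP r X X' \<and> antP r Y Y')"
  "antN r (C \<ominus>\<^sub>r D) Z \<longleftrightarrow> (\<exists>C' D'. Z = C' \<ominus>\<^sub>r D' \<and> sucN r C C' \<and> antN r D D')"
  "antN r (strN N) Z \<longleftrightarrow> Z = strN N \<or> r = AntN N Z"
  "antN r (pfmN p) Z \<longleftrightarrow> Z = pfmN p \<or> r = AntN (PureN p) Z"
  "antN r (sfmN q) Z \<longleftrightarrow> Z = sfmN q \<or> r = AntN (ShiftN q) Z"
  by (subst antN.simps; auto)+

lemma sucN_inv:
  "sucN r (C \<oplus>\<^sub>s D) Z \<longleftrightarrow> (\<exists>C' D'. Z = C' \<oplus>\<^sub>s D' \<and> sucN r C C' \<and> sucN r D D')"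
  "sucN r (X \<setminus>\<^sub>s D) Z \<longleftrightarrow> (\<exists>X' D'. Z = X' \<setminus>\<^sub>s D' \<and> antP r X X' \<and> sucN r D D')"
  "sucN r (D \<sslash>\<^sub>s X) Z \<longleftrightarrow> (\<exists>X' D'. Z = D' \<sslash>\<^sub>s X' \<and> antP r X X' \<and> sucN r D D')"
  "sucN r (strN N) Z \<longleftrightarrow> Z = strN N \<or> r = SucN N Z"
  "sucN r (pfmN p) Z \<longleftrightarrow> Z = pfmN p \<or> r = SucN (PureN p) Z"
  "sucN r (sfmN q) Z \<longleftrightarrow> Z = sfmN q \<or> r = SucN (ShiftN q) Z"
  by (subst sucN.simps; auto)+

lemmas replaces_simps = replaces_cases antP_inv sucP_inv antN_inv sucN_inv

lemmas postulate_intros =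
  display_postulate.intros[THEN postulate.intros(1)]
  display_postulate.intros[THEN postulate.intros(2)]
  structural_postulate.intros[THEN postulate.intros(3)]
  structural_postulate.intros[THEN postulate.intros(4)]

text \<open>Postulates preserve the polarity of every part, so a replacement carries over. When a
  shifted part turns pure, a different postulate connects the results: the one for
  \<open>\<Down>\<^sub>s\<close> gives way to the one for \<open>\<down>\<^sub>s\<close>, and dually
  for \<open>\<Up>\<^sub>s\<close>.\<close>

lemma postulate_replaces:
  assumes "postulate s t" "keeps_pure r" "replaces r s s'"
  shows "\<exists>t'. postulate s' t' \<and> replaces r t t'"
proof -
  have pure: "\<And>\<Xi> \<Xi>'. \<not> antP r (PureX \<Xi>) (ShiftX \<Xi>')" "\<And>\<Delta> \<Delta>'. \<not> sucN r (PureD \<Delta>) (ShiftD \<Delta>')"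
    using assms(2) by (auto dest: antP_pure sucN_pure)
  \<comment> \<open>Splitting on the sort of the replacing structure decides which postulate
    applies.\<close>
  have antE: R if "antP r X X'" "\<And>\<Xi>. X' = PureX \<Xi> \<Longrightarrow> antP r X (PureX \<Xi>) \<Longrightarrow> R"
      "\<And>\<Xi>. X' = ShiftX \<Xi> \<Longrightarrow> antP r X (ShiftX \<Xi>) \<Longrightarrow> R" for X X' R
    using that by (cases X') auto
  have sucE: R if "sucN r D D'" "\<And>\<Delta>. D' = PureD \<Delta> \<Longrightarrow> sucN r D (PureD \<Delta>) \<Longrightarrow> R"
      "\<And>\<Delta>. D' = ShiftD \<Delta> \<Longrightarrow> sucN r D (ShiftD \<Delta>) \<Longrightarrow> R" for D D' R
    using that by (cases D') auto
  show ?thesis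
    using assms(1,3)
    by (elim postulate.cases display_postulate.cases structural_postulate.cases,
        auto simp: replaces_simps)
      ((rule exI, rule conjI, rule postulate_intros, (simp add: replaces_simps; fail)) |
      (erule antE sucE; simp add: pure;
        (rule exI, rule conjI, rule postulate_intros, (simp add: replaces_simps; fail))))+
qed

section \<open>Tracing occurrences up to their introduction\<close>

text \<open>Tracing can stop here: the formula is the entire antecedent, and replacing it is what a
  cut on it would do.\<close>

inductive left_principal :: "replacement \<Rightarrow> sequent \<Rightarrow> sequent \<Rightarrow> bool" where
  "left_principal (AntP P X) (strP P \<turnstile>\<^sub>+ Y) (X \<turnstile>\<^sub>+ Y)"
| "left_principal (AntP P X) (strP P \<turnstile>\<^sub>0 D) (X \<turnstile>\<^sub>0 D)"
| "left_principal (AntN N C) (strN N \<turnstile>\<^sub>- D) (C \<turnstile>\<^sub>- D)"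

inductive right_principal :: "replacement \<Rightarrow> sequent \<Rightarrow> sequent \<Rightarrow> bool" where
  "right_principal (SucP P Y) (X \<turnstile>\<^sub>+ strP P) (X \<turnstile>\<^sub>+ Y)"
| "right_principal (SucN N D) (X \<turnstile>\<^sub>0 strN N) (X \<turnstile>\<^sub>0 D)"
| "right_principal (SucN N D) (C \<turnstile>\<^sub>- strN N) (C \<turnstile>\<^sub>- D)"

lemma axiom_rule_replaces:
  assumes "axiom_rule ps c" "replaces r c c'"
  shows "c' = c \<or> left_principal r c c' \<or> right_principal r c c'"
  using assms
  by (auto elim!: axiom_rule.cases simp: replaces_simps left_principal.simps right_principal.simps)

lemmas left_principal_formula =
  left_principal.intros(1)[of "ShiftP p" for p, simplified]
  left_principal.intros(2)[of "PureP p" for p, simplified]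
  left_principal.intros(3)[of "PureN n" for n, simplified]
  left_principal.intros(3)[of "ShiftN n" for n, simplified]

lemmas right_principal_formula =
  right_principal.intros(1)[of "PureP p" for p, simplified]
  right_principal.intros(1)[of "ShiftP p" for p, simplified]
  right_principal.intros(2)[of "PureN n" for n, simplified]
  right_principal.intros(3)[of "ShiftN n" for n, simplified]

text \<open>Replacements in the context carry over to the premises, while auxiliary formulas stay
  put. If the introduced formula is itself replaced, this is postponed: the rule first yields
  \<open>c''\<close> with the other replacements done.\<close>

lemma left_rule_replaces:
  assumes "left_rule ps c" "replaces r c c'"
  shows "(\<exists>ps'. left_rule ps' c' \<and> list_all2 (replaces r) ps ps') \<or>
    (\<exists>c'' ps'. left_principal r c'' c' \<and> left_rule ps' c'' \<and> list_all2 (replaces r) ps ps')"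
  using assms
  by (elim left_rule.cases, auto simp: replaces_simps del: disjCI)
    ((rule disjI1, rule exI, rule conjI, rule left_rule.intros,
      (simp add: replaces_simps; fail)) |
    (rule disjI2, rule exI, rule conjI, rule left_principal_formula, rule exI, rule conjI,
      rule left_rule.intros, (simp add: replaces_simps; fail)))+

lemma right_rule_replaces:
  assumes "right_rule ps c" "replaces r c c'"
  shows "(\<exists>ps'. right_rule ps' c' \<and> list_all2 (replaces r) ps ps') \<or>
    (\<exists>c'' ps'. right_principal r c'' c' \<and> right_rule ps' c'' \<and> list_all2 (replaces r) ps ps')"
  using assms
  by (elim right_rule.cases, auto simp: replaces_simps del: disjCI)
    ((rule disjI1, rule exI, rule conjI, rule right_rule.intros,
      (simp add: replaces_simps; fail)) |
    (rule disjI2, rule exI, rule conjI, rule right_principal_formula, rule exI, rule conjI,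
      rule right_rule.intros, (simp add: replaces_simps; fail)))+

text \<open>Induction on the derivation pushes the replacement upwards; what remains, the places
  where the traced formula is introduced, is left to the assumptions. An abstract \<open>r\<close>
  serves for both premises of a cut.\<close>

theorem replaces_derivable:
  assumes pure: "keeps_pure r"
    and ax: "\<And>ps c c'. axiom_rule ps c \<Longrightarrow> left_principal r c c' \<or> right_principal r c c'
      \<Longrightarrow> cf_derivable c'"
    and left: "\<And>ps c c'. left_rule ps c \<Longrightarrow> \<forall>p \<in> set ps. cf_derivable p
      \<Longrightarrow> left_principal r c c' \<Longrightarrow> cf_derivable c'"
    and right: "\<And>ps c c'. right_rule ps c \<Longrightarrow> \<forall>p \<in> set ps. cf_derivable p
      \<Longrightarrow> right_principal r c c' \<Longrightarrow> cf_derivable c'"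
    and "cf_derivable c" "replaces r c c'"
  shows "cf_derivable c'"
  using assms(5,6)
proof (induction arbitrary: c' rule: cf_derivable.induct)
  case (axiom ps c)
  then show ?case
    using axiom_rule_replaces ax cf_derivable.axiom by blast
next
  case (left ps c)
  have prem: "\<forall>p \<in> set ps'. cf_derivable p" if "list_all2 (replaces r) ps ps'" for ps'
    using left.IH that by (force simp: list_all2_conv_all_nth in_set_conv_nth)
  consider ps' where "left_rule ps' c'" "list_all2 (replaces r) ps ps'"
    | c'' ps' where "left_principal r c'' c'" "left_rule ps' c''" "list_all2 (replaces r) ps ps'"
    using left_rule_replaces left.hyps left.prems by blast
  then show ?case
  proof cases
    case 1
    then show ?thesis
      using prem cf_derivable.left by blast
  next
    case 2
    then show ?thesis
      using prem assms(3,4) by blast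
  qed
next
  case (right ps c)
  have prem: "\<forall>p \<in> set ps'. cf_derivable p" if "list_all2 (replaces r) ps ps'" for ps'
    using right.IH that by (force simp: list_all2_conv_all_nth in_set_conv_nth)
  consider ps' where "right_rule ps' c'" "list_all2 (replaces r) ps ps'"
    | c'' ps' where "right_principal r c'' c'" "right_rule ps' c''" "list_all2 (replaces r) ps ps'"
    using right_rule_replaces right.hyps right.prems by blast
  then show ?case
  proof cases
    case 1
    then show ?thesis
      using prem cf_derivable.right by blast
  next
    case 2
    then show ?thesis
      using prem assms(3,4) by blast
  qed
next
  case (post s t)
  \<comment> \<open>The replacement is given on the conclusion \<open>t\<close>, so the postulate is
    read backwards, from \<open>t\<close> to \<open>s\<close>.\<close>
  then obtain s' where "postulate t s" "postulate c' s'" "replaces r s s'"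
    using postulate_replaces[OF _ pure] by (meson postulate_sym)
  then show ?case
    using post.IH postulate_sym cf_derivable.post by blast
qed

section \<open>Reduction to principal cuts\<close>

definition cutP :: "gposf \<Rightarrow> bool" where
  "cutP P \<longleftrightarrow> (\<forall>X Y. cf_derivable (X \<turnstile>\<^sub>+ strP P) \<longrightarrow> cf_derivable (strP P \<turnstile>\<^sub>+ Y)
    \<longrightarrow> cf_derivable (X \<turnstile>\<^sub>+ Y))"

definition cutN :: "gnegf \<Rightarrow> bool" where
  "cutN N \<longleftrightarrow> (\<forall>C D. cf_derivable (C \<turnstile>\<^sub>- strN N) \<longrightarrow> cf_derivable (strN N \<turnstile>\<^sub>- D)
    \<longrightarrow> cf_derivable (C \<turnstile>\<^sub>- D))"

text \<open>Two nested traces, with \<open>red\<close> covering the case that \<open>P\<close> is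
  introduced on both sides. There \<open>c\<close> may be neutral, as pure positive formulas are
  introduced on the left of neutral sequents.\<close>

lemma cutP_if_principal_cuts:
  assumes red: "\<And>ps ps' X c c'. right_rule ps (X \<turnstile>\<^sub>+ strP P) \<Longrightarrow> \<forall>p \<in> set ps. cf_derivable p
    \<Longrightarrow> left_rule ps' c \<Longrightarrow> \<forall>p \<in> set ps'. cf_derivable p \<Longrightarrow> left_principal (AntP P X) c c'
    \<Longrightarrow> cf_derivable c'"
  shows "cutP P"
  unfolding cutP_def
proof (intro allI impI)
  fix X Y
  assume X: "cf_derivable (X \<turnstile>\<^sub>+ strP P)" and Y: "cf_derivable (strP P \<turnstile>\<^sub>+ Y)"
  show "cf_derivable (X \<turnstile>\<^sub>+ Y)"
  proof (rule replaces_derivable[where r = "SucP P Y", OF _ _ _ _ X])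
    fix ps c c'
    assume r: "right_rule ps c" "\<forall>p \<in> set ps. cf_derivable p"
      and "right_principal (SucP P Y) c c'"
    then obtain X' where X': "c = (X' \<turnstile>\<^sub>+ strP P)" "c' = (X' \<turnstile>\<^sub>+ Y)"
      by (auto simp: right_principal.simps)
    have "cf_derivable (X' \<turnstile>\<^sub>+ Y)"
    proof (rule replaces_derivable[where r = "AntP P X'", OF _ _ _ _ Y])
      \<comment> \<open>Rules introducing a pure positive formula on the right have a pure
        antecedent.\<close>
      show "keeps_pure (AntP P X')"
        using r(1) by (cases P) (auto simp: X' elim: right_rule.cases)
      \<comment> \<open>An axiom would make \<open>P\<close> an atom, but no right rule introduces
        atoms.\<close>
      show "cf_derivable d'" if "axiom_rule qs d"
        "left_principal (AntP P X') d d' \<or> right_principal (AntP P X') d d'" for qs d d'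
        using that r(1)
        by (auto simp: X' left_principal.simps right_principal.simps
            elim!: axiom_rule.cases elim: right_rule.cases)
      show "cf_derivable d'" if "left_rule qs d" "\<forall>p \<in> set qs. cf_derivable p"
        "left_principal (AntP P X') d d'" for qs d d'
        using red[OF r[unfolded X'] that] .
    qed (simp_all add: right_principal.simps replaces_simps)
    then show "cf_derivable c'"
      by (simp add: X')
  \<comment> \<open>At an axiom the antecedent is \<open>P\<close> itself, so the goal is the right
    premise.\<close>
  qed (use Y in \<open>auto simp: left_principal.simps right_principal.simps replaces_simps
      elim: axiom_rule.cases\<close>)
qed

text \<open>Dual order: with the right premise traced first, \<open>N\<close> in the left premise is
  replaced only by succedents \<open>D'\<close> of its left introductions, which are pure when
  \<open>N\<close> is.\<close>

lemma cutN_if_principal_cuts: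
  assumes red: "\<And>ps ps' D c c'. left_rule ps (strN N \<turnstile>\<^sub>- D) \<Longrightarrow> \<forall>p \<in> set ps. cf_derivable p
    \<Longrightarrow> right_rule ps' c \<Longrightarrow> \<forall>p \<in> set ps'. cf_derivable p \<Longrightarrow> right_principal (SucN N D) c c'
    \<Longrightarrow> cf_derivable c'"
  shows "cutN N"
  unfolding cutN_def
proof (intro allI impI)
  fix C D
  assume C: "cf_derivable (C \<turnstile>\<^sub>- strN N)" and D: "cf_derivable (strN N \<turnstile>\<^sub>- D)"
  show "cf_derivable (C \<turnstile>\<^sub>- D)"
  proof (rule replaces_derivable[where r = "AntN N C", OF _ _ _ _ D])
    fix ps c c'
    assume r: "left_rule ps c" "\<forall>p \<in> set ps. cf_derivable p"
      and "left_principal (AntN N C) c c'"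
    then obtain D' where D': "c = (strN N \<turnstile>\<^sub>- D')" "c' = (C \<turnstile>\<^sub>- D')"
      by (auto simp: left_principal.simps)
    have "cf_derivable (C \<turnstile>\<^sub>- D')"
    proof (rule replaces_derivable[where r = "SucN N D'", OF _ _ _ _ C])
      show "keeps_pure (SucN N D')"
        using r(1) by (cases N) (auto simp: D' elim: left_rule.cases)
      show "cf_derivable d'" if "axiom_rule qs d"
        "left_principal (SucN N D') d d' \<or> right_principal (SucN N D') d d'" for qs d d'
        using that r(1)
        by (auto simp: D' left_principal.simps right_principal.simps
            elim!: axiom_rule.cases elim: left_rule.cases)
      show "cf_derivable d'" if "right_rule qs d" "\<forall>p \<in> set qs. cf_derivable p"
        "right_principal (SucN N D') d d'" for qs d d'
        using red[OF r[unfolded D'] that] .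
    qed (simp_all add: left_principal.simps replaces_simps)
    then show "cf_derivable c'"
      by (simp add: D')
  qed (use C in \<open>auto simp: left_principal.simps right_principal.simps replaces_simps
      elim: axiom_rule.cases\<close>)
qed

section \<open>Reducing neutral cuts\<close>

text \<open>Three shapes are excluded: neutral sequents shifted on both sides, shifted structures
  entailing a pure positive formula, and pure negative formulas entailing a shifted
  structure.\<close>

inductive sort_balanced :: "sequent \<Rightarrow> bool" where
  "sort_balanced (PureX \<Xi> \<turnstile>\<^sub>0 D)"
| "sort_balanced (X \<turnstile>\<^sub>0 PureD \<Delta>)"
| "\<forall>P. Y \<noteq> pfmP P \<Longrightarrow> sort_balanced (X \<turnstile>\<^sub>+ Y)"
| "sort_balanced (PureX \<Xi> \<turnstile>\<^sub>+ Y)"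
| "\<forall>N. C \<noteq> pfmN N \<Longrightarrow> sort_balanced (C \<turnstile>\<^sub>- D)"
| "sort_balanced (C \<turnstile>\<^sub>- PureD \<Delta>)"

text \<open>The shape of the conclusion of each cut-free rule already gives balance, whereas a cut
  may conclude anything.\<close>

lemma cf_derivable_sort_balanced: "cf_derivable c \<Longrightarrow> sort_balanced c"
proof (induction rule: cf_derivable.induct)
  case (axiom ps c)
  then show ?case
    by (auto elim!: axiom_rule.cases simp: sort_balanced.simps)
next
  case (left ps c)
  from left.hyps show ?case
    by (auto elim!: left_rule.cases simp: sort_balanced.simps)
next
  case (right ps c)
  from right.hyps show ?case
    by (auto elim!: right_rule.cases simp: sort_balanced.simps)
next
  case (post s t)
  from post.hyps(1) show ?case
    by (auto elim!: postulate.cases display_postulate.cases structural_postulate.cases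
        simp: sort_balanced.simps)
qed

lemma cf_derivable_iff: "postulate s t \<Longrightarrow> cf_derivable s \<longleftrightarrow> cf_derivable t"
  using cf_derivable.post postulate_sym by blast

text \<open>The numbering follows the clauses of \<open>display_postulate\<close>; numbers 1 to 4
  are the neutral residuations.\<close>

lemmas display_iff = display_postulate.intros[THEN postulate.intros(1), THEN cf_derivable_iff]
lemmas structural_iff = structural_postulate.intros[THEN postulate.intros(3), THEN cf_derivable_iff]

text \<open>A pure \<open>D\<close> moves under \<open>\<down>\<^sub>s\<close>, which makes the cut
  positive. For a shifted \<open>D\<close>, balance forces \<open>P\<close> and then
  \<open>X\<close> to be pure, and \<open>D\<close> moves under \<open>\<Down>\<^sub>s\<close>
  instead.\<close>

lemma cutP_neutral:
  assumes "cutP P" and X: "cf_derivable (X \<turnstile>\<^sub>+ strP P)" and D: "cf_derivable (strP P \<turnstile>\<^sub>0 D)"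
  shows "cf_derivable (X \<turnstile>\<^sub>0 D)"
proof (cases D)
  case (PureD \<Delta>)
  then show ?thesis
    using assms by (auto simp: cutP_def structural_iff)
next
  case (ShiftD \<Delta>)
  obtain p where p: "P = PureP p"
    using cf_derivable_sort_balanced[OF D] ShiftD by (cases P) (auto simp: sort_balanced.simps)
  obtain \<Xi> where \<Xi>: "X = PureX \<Xi>"
    using cf_derivable_sort_balanced[OF X] p by (auto simp: sort_balanced.simps)
  \<comment> \<open>A structural postulate puts \<open>P\<close> under \<open>\<up>\<^sub>s\<close>,
    and a display postulate trades this for \<open>\<Down>\<^sub>s\<close> on the right.\<close>
  have "cf_derivable (strP P \<turnstile>\<^sub>+ \<Down>\<^sub>s \<Delta>)"
    using D by (simp add: p ShiftD structural_iff display_iff)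
  then have "cf_derivable (X \<turnstile>\<^sub>+ \<Down>\<^sub>s \<Delta>)"
    using assms(1) X by (auto simp: cutP_def)
  then show ?thesis
    by (simp add: \<Xi> ShiftD structural_iff display_iff)
qed

lemma cutN_neutral:
  assumes "cutN N" and X: "cf_derivable (X \<turnstile>\<^sub>0 strN N)" and D: "cf_derivable (strN N \<turnstile>\<^sub>- D)"
  shows "cf_derivable (X \<turnstile>\<^sub>0 D)"
proof (cases X)
  case (PureX \<Xi>)
  then show ?thesis
    using assms by (auto simp: cutN_def structural_iff)
next
  case (ShiftX \<Xi>)
  obtain n where n: "N = PureN n"
    using cf_derivable_sort_balanced[OF X] ShiftX by (cases N) (auto simp: sort_balanced.simps)
  obtain \<Delta> where \<Delta>: "D = PureD \<Delta>"
    using cf_derivable_sort_balanced[OF D] n by (auto simp: sort_balanced.simps)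
  have "cf_derivable (\<Up>\<^sub>s \<Xi> \<turnstile>\<^sub>- strN N)"
    using X by (simp add: n ShiftX structural_iff display_iff)
  then have "cf_derivable (\<Up>\<^sub>s \<Xi> \<turnstile>\<^sub>- D)"
    using assms(1) D by (auto simp: cutN_def)
  then show ?thesis
    by (simp add: \<Delta> ShiftX structural_iff display_iff)
qed


section \<open>Principal cuts on each connective\<close>

text \<open>Residuation isolates one subformula at a time: cut on \<open>P\<close>, redisplay, cut
  on \<open>Q\<close>, and move the context back. The other binary connectives follow the same
  scheme.\<close>

lemma tensor_reduction:
  assumes "cutP P" "cutP Q" "cf_derivable (X \<turnstile>\<^sub>+ strP P)" "cf_derivable (Y \<turnstile>\<^sub>+ strP Q)"
    and "cf_derivable (strP P \<otimes>\<^sub>s strP Q \<turnstile>\<^sub>0 D)"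
  shows "cf_derivable (X \<otimes>\<^sub>s Y \<turnstile>\<^sub>0 D)"
proof -
  have "cf_derivable (X \<turnstile>\<^sub>0 D \<sslash>\<^sub>s strP Q)"
    using assms cutP_neutral display_iff(2) by blast
  then have "cf_derivable (strP Q \<turnstile>\<^sub>0 X \<setminus>\<^sub>s D)"
    using display_iff(1,2) by blast
  then have "cf_derivable (Y \<turnstile>\<^sub>0 X \<setminus>\<^sub>s D)"
    using assms cutP_neutral by blast
  then show ?thesis
    using display_iff(1) by blast
qed

lemma oslash_reduction:
  assumes "cutP P" "cutN N" "cf_derivable (X \<turnstile>\<^sub>+ strP P)" "cf_derivable (strN N \<turnstile>\<^sub>- D)"
    and "cf_derivable (strP P \<oslash>\<^sub>s strN N \<turnstile>\<^sub>0 C)"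
  shows "cf_derivable (X \<oslash>\<^sub>s D \<turnstile>\<^sub>0 C)"
proof -
  have "cf_derivable (X \<turnstile>\<^sub>0 C \<oplus>\<^sub>s strN N)"
    using assms cutP_neutral display_iff(3) by blast
  then have "cf_derivable (C \<ominus>\<^sub>s X \<turnstile>\<^sub>0 strN N)"
    using display_iff(4) by blast
  then have "cf_derivable (C \<ominus>\<^sub>s X \<turnstile>\<^sub>0 D)"
    using assms cutN_neutral by blast
  then show ?thesis
    using display_iff(3,4) by blast
qed

lemma ominus_reduction:
  assumes "cutP P" "cutN N" "cf_derivable (X \<turnstile>\<^sub>+ strP P)" "cf_derivable (strN N \<turnstile>\<^sub>- D)"
    and "cf_derivable (strN N \<ominus>\<^sub>s strP P \<turnstile>\<^sub>0 C)"
  shows "cf_derivable (D \<ominus>\<^sub>s X \<turnstile>\<^sub>0 C)"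
proof -
  have "cf_derivable (X \<turnstile>\<^sub>0 strN N \<oplus>\<^sub>s C)"
    using assms cutP_neutral display_iff(4) by blast
  then have "cf_derivable (X \<oslash>\<^sub>s C \<turnstile>\<^sub>0 strN N)"
    using display_iff(3) by blast
  then have "cf_derivable (X \<oslash>\<^sub>s C \<turnstile>\<^sub>0 D)"
    using assms cutN_neutral by blast
  then show ?thesis
    using display_iff(3,4) by blast
qed

lemma oplus_reduction:
  assumes "cutN N" "cutN M" "cf_derivable (strN N \<turnstile>\<^sub>- C)" "cf_derivable (strN M \<turnstile>\<^sub>- D)"
    and "cf_derivable (X \<turnstile>\<^sub>0 strN N \<oplus>\<^sub>s strN M)"
  shows "cf_derivable (X \<turnstile>\<^sub>0 C \<oplus>\<^sub>s D)"
proof -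
  have "cf_derivable (X \<oslash>\<^sub>s strN M \<turnstile>\<^sub>0 C)"
    using assms cutN_neutral display_iff(3) by blast
  then have "cf_derivable (C \<ominus>\<^sub>s X \<turnstile>\<^sub>0 strN M)"
    using display_iff(3,4) by blast
  then have "cf_derivable (C \<ominus>\<^sub>s X \<turnstile>\<^sub>0 D)"
    using assms cutN_neutral by blast
  then show ?thesis
    using display_iff(4) by blast
qed

lemma under_reduction:
  assumes "cutP P" "cutN N" "cf_derivable (X \<turnstile>\<^sub>+ strP P)" "cf_derivable (strN N \<turnstile>\<^sub>- D)"
    and "cf_derivable (Y \<turnstile>\<^sub>0 strP P \<setminus>\<^sub>s strN N)"
  shows "cf_derivable (Y \<turnstile>\<^sub>0 X \<setminus>\<^sub>s D)"
proof -
  have "cf_derivable (strP P \<otimes>\<^sub>s Y \<turnstile>\<^sub>0 D)"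
    using assms cutN_neutral display_iff(1) by blast
  then have "cf_derivable (strP P \<turnstile>\<^sub>0 D \<sslash>\<^sub>s Y)"
    using display_iff(2) by blast
  then have "cf_derivable (X \<turnstile>\<^sub>0 D \<sslash>\<^sub>s Y)"
    using assms cutP_neutral by blast
  then show ?thesis
    using display_iff(1,2) by blast
qed

lemma over_reduction:
  assumes "cutP P" "cutN N" "cf_derivable (X \<turnstile>\<^sub>+ strP P)" "cf_derivable (strN N \<turnstile>\<^sub>- D)"
    and "cf_derivable (Y \<turnstile>\<^sub>0 strN N \<sslash>\<^sub>s strP P)"
  shows "cf_derivable (Y \<turnstile>\<^sub>0 D \<sslash>\<^sub>s X)"
proof -
  have "cf_derivable (Y \<otimes>\<^sub>s strP P \<turnstile>\<^sub>0 D)"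
    using assms cutN_neutral display_iff(2) by blast
  then have "cf_derivable (strP P \<turnstile>\<^sub>0 Y \<setminus>\<^sub>s D)"
    using display_iff(1) by blast
  then have "cf_derivable (X \<turnstile>\<^sub>0 Y \<setminus>\<^sub>s D)"
    using assms cutP_neutral by blast
  then show ?thesis
    using display_iff(1,2) by blast
qed

text \<open>The structural postulate reads \<open>\<down>\<^sub>s\<close> on the right as a neutral
  sequent, so the cut on the shift becomes a neutral cut on \<open>N\<close>.\<close>

lemma down_reduction:
  assumes "cutN (PureN N)" "cf_derivable (X \<turnstile>\<^sub>+ \<down>\<^sub>s (FmD N))" "cf_derivable (pfmN N \<turnstile>\<^sub>- PureD \<Delta>)"
  shows "cf_derivable (X \<turnstile>\<^sub>+ \<down>\<^sub>s \<Delta>)"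
  using cutN_neutral[OF assms(1), of X "PureD \<Delta>"] assms(2,3) by (simp add: structural_iff(1))

lemma up_reduction:
  assumes "cutP (PureP P)" "cf_derivable (\<up>\<^sub>s (FmX P) \<turnstile>\<^sub>- D)" "cf_derivable (PureX \<Xi> \<turnstile>\<^sub>+ pfmP P)"
  shows "cf_derivable (\<up>\<^sub>s \<Xi> \<turnstile>\<^sub>- D)"
  using cutP_neutral[OF assms(1), of "PureX \<Xi>" D] assms(2,3) by (simp add: structural_iff(2))

section \<open>Admissibility of all cuts\<close>

text \<open>Induction on the cut formula suffices: principal cuts reduce to immediate subformulas,
  and the recursion over derivations is inside \<open>replaces_derivable\<close>. The first four
  claims use the injections, so the injection cases are their own induction hypotheses.\<close>

lemma all_cuts:
  "cutP (PureP p)" "cutN (PureN n)" "cutP (ShiftP p')" "cutN (ShiftN n')" "cutP P" "cutN N"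
proof (induction p and n and p' and n' and P and N)
  case (Tensor P Q)
  then show ?case
    by (intro cutP_if_principal_cuts)
      (auto elim!: left_principal.cases left_rule.cases right_rule.cases intro: tensor_reduction)
next
  case (Oslash P N)
  then show ?case
    by (intro cutP_if_principal_cuts)
      (auto elim!: left_principal.cases left_rule.cases right_rule.cases intro: oslash_reduction)
next
  case (Ominus N P)
  then show ?case
    by (intro cutP_if_principal_cuts)
      (auto elim!: left_principal.cases left_rule.cases right_rule.cases intro: ominus_reduction)
next
  case (Oplus N M)
  then show ?case
    by (intro cutN_if_principal_cuts)
      (auto elim!: right_principal.cases left_rule.cases right_rule.cases intro: oplus_reduction)
next
  case (Under P N)
  then show ?case
    by (intro cutN_if_principal_cuts)
      (auto elim!: right_principal.cases left_rule.cases right_rule.cases intro: under_reduction)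
next
  case (Over N P)
  then show ?case
    by (intro cutN_if_principal_cuts)
      (auto elim!: right_principal.cases left_rule.cases right_rule.cases intro: over_reduction)
next
  case (Down N)
  then show ?case
    by (intro cutP_if_principal_cuts)
      (auto elim!: left_principal.cases left_rule.cases right_rule.cases intro: down_reduction)
next
  case (Up P)
  then show ?case
    by (intro cutN_if_principal_cuts)
      (auto elim!: right_principal.cases left_rule.cases right_rule.cases intro: up_reduction)
next
  \<comment> \<open>No right rule introduces an atom, so there is no principal cut to
    reduce.\<close>
  case (AtomP a)
  show ?case
    by (intro cutP_if_principal_cuts) (auto elim: right_rule.cases)
next
  case (AtomN a)
  show ?case
    by (intro cutN_if_principal_cuts) (auto elim: left_rule.cases)
qed

lemma cut_rule_admissible:
  assumes "cut_rule ps c" "\<forall>p \<in> set ps. cf_derivable p"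
  shows "cf_derivable c"
  using assms all_cuts(5,6)
  by cases (auto simp: cutP_def cutN_def
      intro: cutP_neutral[OF all_cuts(5)] cutN_neutral[OF all_cuts(6)])

section \<open>Passing between derivation trees and cut-free derivability\<close>

lemma translation_rule_split: "translation_rule ps c \<Longrightarrow> left_rule ps c \<or> right_rule ps c"
  by (auto elim!: translation_rule.cases intro: left_rule.intros right_rule.intros)

lemma tonicity_rule_split: "tonicity_rule ps c \<Longrightarrow> left_rule ps c \<or> right_rule ps c"
  by (auto elim!: tonicity_rule.cases intro: left_rule.intros right_rule.intros)

lemma fDLG_rule_admissible:
  assumes "fDLG_rule k ps c" "\<forall>p \<in> set ps. cf_derivable p"
  shows "cf_derivable c"
  using assms
proof cases
  case 1
  then show ?thesis by (blast intro: cf_derivable.axiom)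
next
  case 2
  then show ?thesis using assms(2) by (blast intro: cut_rule_admissible)
next
  case 3
  then show ?thesis using assms(2) translation_rule_split cf_derivable.left cf_derivable.right
    by blast
next
  case 4
  then show ?thesis using assms(2) tonicity_rule_split cf_derivable.left cf_derivable.right
    by blast
qed (use assms(2) in \<open>auto intro: cf_derivable.post postulate.intros\<close>)

lemma fDLG_derivation_imp_cf_derivable: "fDLG_derivation d \<Longrightarrow> cf_derivable (end_sequent d)"
  by (induction rule: fDLG_derivation.induct) (simp, erule fDLG_rule_admissible, simp)

lemma left_rule_fDLG: "left_rule ps c \<Longrightarrow> fDLG_rule Translation ps c \<or> fDLG_rule Tonicity ps c"
  by (auto elim!: left_rule.cases
      intro: fDLG_rule.intros translation_rule.intros tonicity_rule.intros)

lemma right_rule_fDLG: "right_rule ps c \<Longrightarrow> fDLG_rule Translation ps c \<or> fDLG_rule Tonicity ps c"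
  by (auto elim!: right_rule.cases
      intro: fDLG_rule.intros translation_rule.intros tonicity_rule.intros)

lemma postulate_fDLG: "postulate s t \<Longrightarrow> fDLG_rule Display [s] t \<or> fDLG_rule Structural [s] t"
  by (auto elim!: postulate.cases intro: fDLG_rule.intros)

definition cf_derivation :: "deriv \<Rightarrow> sequent \<Rightarrow> bool" where
  "cf_derivation d c \<longleftrightarrow> fDLG_derivation d \<and> end_sequent d = c \<and> cut_free d"

lemma cf_derivation_step:
  assumes "fDLG_rule k ps c" "k \<noteq> Cut" "\<And>p. p \<in> set ps \<Longrightarrow> \<exists>d. cf_derivation d p"
  shows "\<exists>d. cf_derivation d c"
proof -
  \<comment> \<open>One derivation is chosen per premise sequent; mapping \<open>f\<close> over
    \<open>ps\<close> then restores the premise list in order.\<close>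
  obtain f where f: "cf_derivation (f p) p" if "p \<in> set ps" for p
    using assms(3) by metis
  have "map end_sequent (map f ps) = ps"
    using f by (auto simp: cf_derivation_def intro: map_idI)
  then have "cf_derivation (Infer k c (map f ps)) c"
    using assms(1,2) f by (auto simp: cf_derivation_def intro!: fDLG_derivation.intros)
  then show ?thesis ..
qed

lemma cf_derivable_imp_cf_derivation: "cf_derivable c \<Longrightarrow> \<exists>d. cf_derivation d c"
proof (induction rule: cf_derivable.induct)
  case (axiom ps c)
  then have "ps = []"
    by (auto elim: axiom_rule.cases)
  with axiom show ?case
    using cf_derivation_step[OF fDLG_rule.intros(1)] by fastforce
next
  case (left ps c)
  then show ?case
    using cf_derivation_step left_rule_fDLG by blast
next
  case (right ps c)
  then show ?case
    using cf_derivation_step right_rule_fDLG by blast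
next
  case (post s t)
  then have "\<exists>d. cf_derivation d p" if "p \<in> set [s]" for p
    using that by simp
  then show ?case
    using cf_derivation_step postulate_fDLG[OF post.hyps(1)] by blast
qed

theorem corollary41:
  fixes d :: deriv
  assumes "fDLG_derivation d"
  shows "\<exists>d'. fDLG_derivation d' \<and> end_sequent d' = end_sequent d \<and> cut_free d'"
  using cf_derivable_imp_cf_derivation[OF fDLG_derivation_imp_cf_derivable[OF assms]]
  by (simp add: cf_derivation_def)

end
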